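(* Fix any constant deletion rate $0<\delta<1$. There is a suitable absolute constant $c_0>0$ such that any $c_0 n^{1/5}/(\log n)^{2/5}$-local SQ algorithm for worst-case trace reconstruction (of $n$-bit strings) must have tolerance $\tau_0 < \exp\bigl(-\Omega(n^{1/5}/(\log n)^{2/5})\bigr)$.
   Context: Trace reconstruction: fix a deletion rate $\delta\in(0,1)$. For a source string $x=(x_0,\dots,x_{n-1})\in\{0,1\}^n$, a random trace $\mathbf y\sim \mathrm{Del}_\delta(x)$ is obtained by deleting each bit of $x$ independently with probability $\delta$ and concatenating the surviving bits. Each trace is padded with a suffix of zeros to length $n$ (equivalently $x$ is padded by infinitely many zeros), so $\mathbf y_i$ is defined for every $i$. A statistical query (SQ) oracle for $x$ takes a query function $q:\{0,1\}^n\to[-1,1]$ and a tolerance $\tau\in(0,1)$ and returns some value $\widehat P_q$ with $|\widehat P_q - \mathbb E_{\mathbf y\sim \mathrm{Del}_\delta(x)}[q(\mathbf y)]|\le\tau$. A query $q$ is $\ell$-local if $q(y)=q'(y_i,y_{i+1},\dots,y_{i+\ell-1})$ for some index $i$ and some $q':\{0,1\}^\ell\to[-1,1]$. An $\ell$-local SQ algorithm with tolerance $\tau_0$ is an algorithm (possibly adaptive) all of whose oracle calls use $\ell$-local query functions and tolerance at least $\tau_0$. It solves worst-case trace reconstruction if for every $x\in\{0,1\}^n$ and every valid sequence of oracle responses it outputs $x$. Here $\log$ is base 2. *)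

theory Defs
  imports "HOL-Probability.Probability"
begin

definition del_channel :: "real \<Rightarrow> bool list \<Rightarrow> bool list pmf" where
  "del_channel \<delta> x =
     map_pmf (\<lambda>deleted. nths x {i. \<not> deleted i})
       (Pi_pmf {..<length x} False (\<lambda>_. bernoulli_pmf \<delta>))"

definition pad_zeros :: "nat \<Rightarrow> bool list \<Rightarrow> bool list" where
  "pad_zeros n y = y @ replicate (n - length y) False"

definition padded_trace :: "real \<Rightarrow> bool list \<Rightarrow> bool list pmf" where
  "padded_trace \<delta> x = map_pmf (pad_zeros (length x)) (del_channel \<delta> x)"

text \<open>
  Positions beyond the end of \<open>y\<close> read as zero, so a window may start at any index.
\<close>

definition window :: "nat \<Rightarrow> nat \<Rightarrow> bool list \<Rightarrow> bool list" where
  "window i l y = map (\<lambda>j. j < length y \<and> y ! j) [i..<i + l]"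

definition local_query :: "nat \<Rightarrow> nat \<Rightarrow> (bool list \<Rightarrow> real) \<Rightarrow> bool" where
  "local_query n l q \<longleftrightarrow>
     (\<exists>i q'. (\<forall>w. length w = l \<longrightarrow> q' w \<in> {-1..1}) \<and>
             (\<forall>y. length y = n \<longrightarrow> q y = q' (window i l y)))"

text \<open>
  An adaptive algorithm is a decision tree: it either halts with an output, or asks a query
  with a tolerance and continues depending on the real number returned by the oracle.
  The tree may be infinitely deep overall, but each of its branches is finite.
\<close>

datatype sq_algorithm =
    Output "bool list"
  | Query "bool list \<Rightarrow> real" real "real \<Rightarrow> sq_algorithm"

primrec local_sq_algorithm :: "nat \<Rightarrow> nat \<Rightarrow> real \<Rightarrow> sq_algorithm \<Rightarrow> bool" where
  "local_sq_algorithm n l \<tau>\<^sub>0 (Output z) \<longleftrightarrow> True"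
| "local_sq_algorithm n l \<tau>\<^sub>0 (Query q \<tau> k) \<longleftrightarrow>
     local_query n l q \<and> \<tau> \<in> {0<..<1} \<and> \<tau>\<^sub>0 \<le> \<tau> \<and> (\<forall>r. local_sq_algorithm n l \<tau>\<^sub>0 (k r))"

text \<open>
  \<open>sq_run \<delta> x A z\<close>: some valid sequence of responses of the oracle for \<open>x\<close> makes \<open>A\<close> output \<open>z\<close>.
  As branches are finite and a valid response always exists, every valid
  sequence of responses leads to an output.
\<close>

inductive sq_run :: "real \<Rightarrow> bool list \<Rightarrow> sq_algorithm \<Rightarrow> bool list \<Rightarrow> bool" for \<delta> x where
  run_output: "sq_run \<delta> x (Output z) z"
| run_query: "\<bar>r - measure_pmf.expectation (padded_trace \<delta> x) q\<bar> \<le> \<tau> \<Longrightarrow> sq_run \<delta> x (k r) z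
          \<Longrightarrow> sq_run \<delta> x (Query q \<tau> k) z"

definition solves_trace_reconstruction :: "real \<Rightarrow> nat \<Rightarrow> sq_algorithm \<Rightarrow> bool" where
  "solves_trace_reconstruction \<delta> n A \<longleftrightarrow>
     (\<forall>x z. length x = n \<longrightarrow> sq_run \<delta> x A z \<longrightarrow> z = x)"

end

theory Submission
  imports Defs "HOL-Real_Asymp.Real_Asymp"
begin

text \<open>
  Let \<open>\<Lambda> = n powr (1/5) / log 2 n powr (2/5)\<close> and \<open>p = 1 - \<delta>\<close>. Take strings whose ones sit at positions
  \<open>s + G t\<close> with \<open>t < N\<close>, where \<open>s = n / 2\<close> and \<open>G\<close> is about \<open>4 \<Lambda> / p\<close>. A window of length at most \<open>\<Lambda>\<close>
  of the trace then contains two ones with probability at most \<open>n exp (- \<Lambda>)\<close> only, so up to that error every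
  local query is an affine function of the one-bit probabilities \<open>Pr[y\<^sub>j = 1]\<close>.
  These are the coefficients of \<open>p \<Sum>\<^sub>m x\<^sub>m w ^ m\<close>, where \<open>w = \<delta> + p z\<close>.

  If \<open>N > D\<^sup>2 log 2 n\<close>, the pigeonhole principle gives two such strings whose sums of \<open>G t choose r\<close>
  agree for all \<open>r < D\<close>. Expanding \<open>w ^ (G t)\<close> in powers of \<open>h = w - 1\<close>, the difference of the generating
  functions on the unit circle is at most \<open>2 N \<bar>w\<bar> ^ s exp (e \<bar>h\<bar> G N - D)\<close>, and
  \<open>\<bar>w\<bar> ^ s \<le> exp (- \<delta> s \<bar>h\<bar>\<^sup>2 / (2 p))\<close>. With \<open>D = a \<Lambda>\<close> for a small constant \<open>a\<close>
  this is at most \<open>2 N exp (- D / 2)\<close>, because \<open>(G N)\<^sup>2\<close> is of order \<open>a\<^sup>4 \<Lambda> n\<close>, which is small against \<open>D n\<close>.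
  An oracle answering with the midpoint of the two expectations cannot separate the two strings.
\<close>

section \<open>The deletion channel as a recursion on the source string\<close>

abbreviation trace_expectation :: "real \<Rightarrow> bool list \<Rightarrow> (bool list \<Rightarrow> real) \<Rightarrow> real" where
  "trace_expectation \<delta> x \<equiv> measure_pmf.expectation (del_channel \<delta> x)"

text \<open>Positions past the end read as zero, so padding is invisible and the unpadded channel
  suffices.\<close>

definition bit_at :: "bool list \<Rightarrow> nat \<Rightarrow> bool" where
  "bit_at y j \<longleftrightarrow> j < length y \<and> y ! j"

lemma bit_at_Nil [simp]: "\<not> bit_at [] j"
  and bit_at_Cons_0 [simp]: "bit_at (b # y) 0 = b"
  and bit_at_Cons_Suc [simp]: "bit_at (b # y) (Suc j) = bit_at y j"
  by (simp_all add: bit_at_def)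

lemma window_eq_bit_at: "window i l y = map (bit_at y) [i..<i + l]"
  by (simp add: window_def bit_at_def)

lemma window_pad_zeros: "window i l (pad_zeros n y) = window i l y"
  by (auto simp: window_def pad_zeros_def nth_append)

lemma del_channel_Nil [simp]: "del_channel \<delta> [] = return_pmf []"
  by (simp add: del_channel_def)

text \<open>The decision about the first bit is independent of the rest; shifting the other indices
  by \<open>Suc\<close> gives the channel on \<open>x\<close>. Inductions on the source string rest
  on this recursion, not on the product measure.\<close>

lemma del_channel_Cons:
  "del_channel \<delta> (b # x) =
     bind_pmf (bernoulli_pmf \<delta>) (\<lambda>d. map_pmf (\<lambda>y. if d then y else b # y) (del_channel \<delta> x))"
proof -
  let ?B = "\<lambda>_::nat. bernoulli_pmf \<delta>"
  have shift: "Pi_pmf {..<length x} False ?B =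
      map_pmf (\<lambda>g. g \<circ> Suc) (Pi_pmf (Suc ` {..<length x}) False ?B)"
    by (rule Pi_pmf_bij_betw) (auto simp: bij_betw_def)
  have "del_channel \<delta> (b # x) = bind_pmf (bernoulli_pmf \<delta>) (\<lambda>d.
      map_pmf (\<lambda>f. nths (b # x) {i. \<not> (f(0 := d)) i}) (Pi_pmf (Suc ` {..<length x}) False ?B))"
    unfolding del_channel_def
    by (simp add: lessThan_Suc_eq_insert_0 Pi_pmf_insert' map_bind_pmf map_pmf_def
        bind_assoc_pmf bind_return_pmf)
  also have "\<dots> = bind_pmf (bernoulli_pmf \<delta>) (\<lambda>d.
      map_pmf (\<lambda>y. if d then y else b # y) (del_channel \<delta> x))"
    unfolding del_channel_def shift
    by (auto simp: map_pmf_comp nths_Cons o_def intro!: bind_pmf_cong map_pmf_cong)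
  finally show ?thesis .
qed

lemma finite_set_pmf_del_channel [simp]: "finite (set_pmf (del_channel \<delta> x))"
  by (induction x) (auto simp: del_channel_Cons)

lemma integrable_del_channel [simp]:
  "integrable (measure_pmf (del_channel \<delta> x)) (f :: bool list \<Rightarrow> real)"
  by (rule integrable_measure_pmf_finite) simp

lemma length_trace_le: "y \<in> set_pmf (del_channel \<delta> x) \<Longrightarrow> length y \<le> length x"
  by (induction x arbitrary: y) (fastforce simp: del_channel_Cons split: if_splits)+

lemma trace_expectation_Cons:
  assumes "0 \<le> \<delta>" "\<delta> \<le> 1"
  shows "trace_expectation \<delta> (b # x) f =
    \<delta> * trace_expectation \<delta> x f + (1 - \<delta>) * trace_expectation \<delta> x (\<lambda>y. f (b # y))"
  unfolding del_channel_Cons using assms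
  by (subst pmf_expectation_bind[of UNIV]) (auto simp: UNIV_bool)

lemma trace_expectation_mono:
  "(\<And>y. f y \<le> g y) \<Longrightarrow> trace_expectation \<delta> x f \<le> trace_expectation \<delta> x g"
  by (intro integral_mono) auto

text \<open>A trace is never longer than its source, so the padded trace has length exactly
  \<open>length x\<close>, where the hypothesis on \<open>q\<close> applies, and the window does not
  see the padding.\<close>

lemma expectation_padded_trace_local_query:
  assumes "\<And>y. length y = length x \<Longrightarrow> q y = q' (window i l y)"
  shows "measure_pmf.expectation (padded_trace \<delta> x) q = trace_expectation \<delta> x (\<lambda>y. q' (window i l y))"
proof -
  have "measure_pmf.expectation (padded_trace \<delta> x) q =
      trace_expectation \<delta> x (\<lambda>y. q (pad_zeros (length x) y))"
    by (simp add: padded_trace_def)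
  also have "\<dots> = trace_expectation \<delta> x (\<lambda>y. q' (window i l y))"
  proof (rule integral_cong_AE)
    show "AE y in measure_pmf (del_channel \<delta> x). q (pad_zeros (length x) y) = q' (window i l y)"
    proof (rule AE_pmfI)
      fix y assume "y \<in> set_pmf (del_channel \<delta> x)"
      hence "length (pad_zeros (length x) y) = length x"
        by (auto simp: pad_zeros_def dest: length_trace_le)
      thus "q (pad_zeros (length x) y) = q' (window i l y)"
        using assms by (simp add: window_pad_zeros)
    qed
  qed auto
  finally show ?thesis .
qed

section \<open>One-bit statistics\<close>

definition bit_prob :: "real \<Rightarrow> bool list \<Rightarrow> nat \<Rightarrow> real" where
  "bit_prob \<delta> x j = trace_expectation \<delta> x (\<lambda>y. of_bool (bit_at y j))"

lemma bit_prob_eq_0: "length x \<le> j \<Longrightarrow> bit_prob \<delta> x j = 0"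
proof -
  assume "length x \<le> j"
  have "bit_prob \<delta> x j = trace_expectation \<delta> x (\<lambda>y. 0)"
    unfolding bit_prob_def
    by (rule integral_cong_AE)
       (use \<open>length x \<le> j\<close> in \<open>auto intro!: AE_pmfI simp: bit_at_def dest: length_trace_le\<close>)
  thus ?thesis by simp
qed

lemma bit_prob_Cons:
  assumes "0 \<le> \<delta>" "\<delta> \<le> 1"
  shows "bit_prob \<delta> (b # x) 0 = \<delta> * bit_prob \<delta> x 0 + (1 - \<delta>) * of_bool b"
    and "bit_prob \<delta> (b # x) (Suc j) = \<delta> * bit_prob \<delta> x (Suc j) + (1 - \<delta>) * bit_prob \<delta> x j"
  using assms by (simp_all add: bit_prob_def trace_expectation_Cons)

text \<open>If it survives (factor \<open>1 - \<delta>\<close>), source bit \<open>m\<close> lands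
  at the number of survivors among the \<open>m\<close> bits before it, a binomial variable with
  generating function \<open>w ^ m\<close>, where
  \<open>w = \<delta> + (1 - \<delta>) z\<close>.\<close>

lemma bit_prob_generating_function:
  fixes z :: complex
  assumes "0 \<le> \<delta>" "\<delta> \<le> 1"
  shows "(\<Sum>j<length x. of_real (bit_prob \<delta> x j) * z ^ j) =
    of_real (1 - \<delta>) * (\<Sum>m<length x. of_bool (x ! m) * (of_real \<delta> + of_real (1 - \<delta>) * z) ^ m)"
proof (induction x)
  case Nil
  show ?case by simp
next
  case (Cons b x)
  let ?w = "of_real \<delta> + of_real (1 - \<delta>) * z"
  let ?P = "\<Sum>j<length x. of_real (bit_prob \<delta> x j) * z ^ j"
  \<comment> \<open>\<open>bit_prob\<close> vanishes at index \<open>length x\<close>, so one more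
    term may be added before shifting.\<close>
  have P: "?P = of_real (bit_prob \<delta> x 0) + (\<Sum>j<length x. of_real (bit_prob \<delta> x (Suc j)) * z ^ Suc j)"
  proof -
    have "?P = (\<Sum>j<Suc (length x). of_real (bit_prob \<delta> x j) * z ^ j)"
      by (simp add: bit_prob_eq_0)
    thus ?thesis by (simp only: sum.lessThan_Suc_shift) simp
  qed
  have "(\<Sum>j<length (b # x). of_real (bit_prob \<delta> (b # x) j) * z ^ j) =
      of_real (bit_prob \<delta> (b # x) 0) + (\<Sum>j<length x. of_real (bit_prob \<delta> (b # x) (Suc j)) * z ^ Suc j)"
    by (simp only: list.size sum.lessThan_Suc_shift add_Suc_right add_0_right) simp
  also have "\<dots> = of_real \<delta> * (of_real (bit_prob \<delta> x 0) +
        (\<Sum>j<length x. of_real (bit_prob \<delta> x (Suc j)) * z ^ Suc j))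
      + of_real (1 - \<delta>) * of_bool b + of_real (1 - \<delta>) * z * ?P"
    by (simp only: bit_prob_Cons[OF assms] of_real_add of_real_mult ring_distribs sum.distrib
        sum_distrib_left power_Suc)
       (simp add: algebra_simps of_bool_def)
  also have "\<dots> = of_real (1 - \<delta>) * of_bool b + ?w * ?P"
    by (subst P[symmetric]) (simp add: algebra_simps)
  also have "\<dots> = of_real (1 - \<delta>) * (of_bool b + ?w * (\<Sum>m<length x. of_bool (x ! m) * ?w ^ m))"
    by (subst Cons.IH) (simp add: algebra_simps)
  also have "of_bool b + ?w * (\<Sum>m<length x. of_bool (x ! m) * ?w ^ m) =
      (\<Sum>m<length (b # x). of_bool ((b # x) ! m) * ?w ^ m)"
    by (simp only: list.size sum.lessThan_Suc_shift add_Suc_right add_0_right)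
       (simp add: sum_distrib_left mult_ac)
  finally show ?case .
qed

text \<open>Orthogonality of the characters of the cyclic group of order \<open>n\<close>: for
  \<open>i \<noteq> j\<close> this is a geometric sum whose ratio is an \<open>n\<close>-th root of
  unity, different from \<open>1\<close> because \<open>\<bar>i - j\<bar> < n\<close>.\<close>

lemma sum_cis_roots_of_unity:
  fixes i j n :: nat
  assumes "i < n" "j < n"
  shows "(\<Sum>k<n. cis (2 * pi * real k / real n) ^ i * cis (- (2 * pi * real k / real n)) ^ j) =
    (if i = j then of_nat n else 0)"
proof (cases "i = j")
  case True
  have "cis t ^ j * cis (- t) ^ j = 1" for t
    by (simp flip: power_mult_distrib add: cis_mult)
  thus ?thesis using True by simp
next
  case False
  define u where "u = cis (2 * pi * (real i - real j) / real n)"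
  have term_eq: "cis (2 * pi * real k / real n) ^ i * cis (- (2 * pi * real k / real n)) ^ j = u ^ k" for k
    unfolding u_def Complex.DeMoivre cis_mult by (rule arg_cong[of _ _ cis]) (use assms in \<open>simp add: divide_simps algebra_simps\<close>)
  have "u \<noteq> 1"
  proof
    assume "u = 1"
    hence "cos (2 * pi * (real i - real j) / real n) = 1"
      by (simp add: u_def complex_eq_iff)
    then obtain m :: int where "2 * pi * (real i - real j) / real n = of_int m * 2 * pi"
      by (auto simp: cos_one_2pi_int)
    hence "(2 * pi) * (real i - real j) = (2 * pi) * (of_int m * real n)"
      using assms by (simp add: field_simps)
    hence "real i - real j = of_int m * real n"
      by (subst (asm) mult_cancel_left) simp
    hence "int i - int j = m * int n"
      by (metis of_int_diff of_int_eq_iff of_int_mult of_int_of_nat_eq)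
    moreover have "\<bar>int i - int j\<bar> < int n" using assms by auto
    ultimately have "\<bar>m\<bar> * int n < 1 * int n" by (simp add: abs_mult)
    hence "m = 0" using assms by (simp only: mult_less_cancel_right) auto
    thus False using \<open>int i - int j = m * int n\<close> False by simp
  qed
  moreover have "u ^ n = 1"
  proof -
    have "u ^ n = cis (2 * pi * (real i - real j))"
      using assms by (simp add: u_def Complex.DeMoivre)
    also have "\<dots> = 1" by (rule cis_multiple_2pi) simp
    finally show ?thesis .
  qed
  ultimately show ?thesis
    using False by (simp add: term_eq sum_gp_strict)
qed

text \<open>A discrete Cauchy estimate: averaging over the \<open>n\<close>-th roots of unity
  recovers a coefficient exactly, since the degree is below \<open>n\<close>.\<close>

lemma norm_coeff_le_sup_unit_circle:
  fixes c :: "nat \<Rightarrow> complex"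
  assumes bound: "\<And>z. norm z = 1 \<Longrightarrow> norm (\<Sum>i<n. c i * z ^ i) \<le> B" and "j < n"
  shows "norm (c j) \<le> B"
proof -
  let ?\<omega> = "\<lambda>k. cis (2 * pi * real k / real n)"
  let ?\<omega>' = "\<lambda>k. cis (- (2 * pi * real k / real n))"
  have "(\<Sum>k<n. (\<Sum>i<n. c i * ?\<omega> k ^ i) * ?\<omega>' k ^ j) =
      (\<Sum>i<n. c i * (\<Sum>k<n. ?\<omega> k ^ i * ?\<omega>' k ^ j))"
    unfolding sum_distrib_left sum_distrib_right
    by (subst sum.swap) (simp add: mult_ac)
  also have "\<dots> = (\<Sum>i<n. if i = j then c j * of_nat n else 0)"
    by (intro sum.cong) (use \<open>j < n\<close> in \<open>auto simp: sum_cis_roots_of_unity\<close>)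
  also have "\<dots> = c j * of_nat n"
    using \<open>j < n\<close> by simp
  finally have "real n * norm (c j) = norm (\<Sum>k<n. (\<Sum>i<n. c i * ?\<omega> k ^ i) * ?\<omega>' k ^ j)"
    by (simp add: norm_mult)
  also have "\<dots> \<le> (\<Sum>k<n. B)"
    by (rule order.trans[OF norm_sum], rule sum_mono) (simp add: norm_mult norm_power bound)
  finally show ?thesis using \<open>j < n\<close> by simp
qed

section \<open>Windows containing two ones\<close>

text \<open>Not tied to one window: a single event controls all windows of length \<open>l\<close>
  at once.\<close>

definition crowded :: "nat \<Rightarrow> bool list \<Rightarrow> bool" where
  "crowded l y \<longleftrightarrow> (\<exists>i j. i < j \<and> j < i + l \<and> bit_at y i \<and> bit_at y j)"

definition spaced :: "nat \<Rightarrow> bool list \<Rightarrow> bool" where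
  "spaced G x \<longleftrightarrow> (\<forall>i j. i < j \<longrightarrow> bit_at x i \<longrightarrow> bit_at x j \<longrightarrow> i + G \<le> j)"

lemma crowded_Nil [simp]: "\<not> crowded l []"
  by (simp add: crowded_def)

lemma crowded_ConsD: "crowded l (b # y) \<Longrightarrow> crowded l y \<or> b \<and> (\<exists>j<l. bit_at y j)"
proof -
  assume "crowded l (b # y)"
  then obtain i j where ij: "i < j" "j < i + l" "bit_at (b # y) i" "bit_at (b # y) j"
    by (auto simp: crowded_def)
  then obtain j' where j': "j = Suc j'" by (cases j) auto
  show ?thesis
  proof (cases i)
    case 0
    thus ?thesis using ij j' by (auto intro!: exI[of _ j'])
  next
    case (Suc i')
    hence "crowded l y" unfolding crowded_def
      by (intro exI[of _ i'] exI[of _ j']) (use ij j' Suc in auto)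
    thus ?thesis ..
  qed
qed

text \<open>A gap of \<open>Suc g\<close> leaves \<open>g\<close> zeros after each one; this is the
  exponent \<open>g\<close> in the bounds below.\<close>

lemma spaced_ConsD:
  assumes "spaced (Suc g) (b # x)"
  shows "spaced (Suc g) x" and "b \<Longrightarrow> i < g \<Longrightarrow> \<not> bit_at x i"
proof -
  show "spaced (Suc g) x"
    unfolding spaced_def
  proof (intro allI impI)
    fix i j assume "i < j" "bit_at x i" "bit_at x j"
    thus "i + Suc g \<le> j"
      using assms[unfolded spaced_def, rule_format, of "Suc i" "Suc j"] by simp
  qed
  show "\<not> bit_at x i" if "b" "i < g"
    using assms[unfolded spaced_def, rule_format, of 0 "Suc i"] that by auto
qed

text \<open>Chernoff's method: an early one requires that fewer than \<open>l\<close> of the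
  \<open>g\<close> leading zeros survive, and the base of the power is the mean of
  \<open>exp (-1)\<close> to the indicator of survival. The induction varies \<open>l\<close>
  because each surviving zero uses up one position of the window.\<close>

lemma prob_early_one_le:
  assumes \<delta>: "0 \<le> \<delta>" "\<delta> \<le> 1" and "\<And>i. i < g \<Longrightarrow> \<not> bit_at x i"
  shows "trace_expectation \<delta> x (\<lambda>y. of_bool (\<exists>j<l. bit_at y j)) \<le> exp (real l) * (\<delta> + (1 - \<delta>) * exp (-1)) ^ g"
  using assms(3)
proof (induction g arbitrary: x l)
  case 0
  have "trace_expectation \<delta> x (\<lambda>y. of_bool (\<exists>j<l. bit_at y j)) \<le> trace_expectation \<delta> x (\<lambda>y. 1)"
    by (rule trace_expectation_mono) auto
  also have "\<dots> \<le> exp l" by simp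
  finally show ?case by simp
next
  case (Suc g)
  let ?\<beta> = "\<delta> + (1 - \<delta>) * exp (-1)"
  have \<beta>: "?\<beta> \<ge> 0" using \<delta> by simp
  show ?case
  proof (cases x)
    case Nil
    thus ?thesis using \<beta> by simp
  next
    case (Cons b x')
    hence b: "\<not> b" and x': "\<And>i. i < g \<Longrightarrow> \<not> bit_at x' i"
      using Suc.prems[of 0] Suc.prems[of "Suc _"] by auto
    show ?thesis
    proof (cases l)
      case 0
      thus ?thesis using \<beta> by simp
    next
      case l: (Suc l')
      have "(\<exists>j<l. bit_at (b # y) j) \<longleftrightarrow> (\<exists>j<l'. bit_at y j)" for y
        using b by (simp add: l Ex_less_Suc2)
      hence "trace_expectation \<delta> x (\<lambda>y. of_bool (\<exists>j<l. bit_at y j)) =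
          \<delta> * trace_expectation \<delta> x' (\<lambda>y. of_bool (\<exists>j<l. bit_at y j)) +
          (1 - \<delta>) * trace_expectation \<delta> x' (\<lambda>y. of_bool (\<exists>j<l'. bit_at y j))"
        using \<delta> by (simp add: Cons trace_expectation_Cons)
      also have "\<dots> \<le> \<delta> * (exp l * ?\<beta> ^ g) + (1 - \<delta>) * (exp l' * ?\<beta> ^ g)"
        using \<delta> by (intro add_mono mult_left_mono Suc.IH x') auto
      also have "exp (real l') = exp l * exp (-1)"
        by (simp flip: exp_add add: l)
      finally show ?thesis by (simp add: algebra_simps)
    qed
  qed
qed

text \<open>A union bound over the earlier one of the close pair: the next \<open>g\<close> source
  bits are zeros, so \<open>prob_early_one_le\<close> bounds the chance of another one within
  reach.\<close>

lemma prob_crowded_le: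
  assumes \<delta>: "0 \<le> \<delta>" "\<delta> \<le> 1" and "spaced (Suc g) x"
  shows "trace_expectation \<delta> x (\<lambda>y. of_bool (crowded l y)) \<le>
    length x * (exp l * (\<delta> + (1 - \<delta>) * exp (-1)) ^ g)"
  using assms(3)
proof (induction x)
  case Nil
  show ?case by simp
next
  case (Cons b x)
  let ?E = "exp (real l) * (\<delta> + (1 - \<delta>) * exp (-1)) ^ g"
  let ?c = "trace_expectation \<delta> x (\<lambda>y. of_bool (crowded l y))"
  let ?h = "trace_expectation \<delta> x (\<lambda>y. of_bool (b \<and> (\<exists>j<l. bit_at y j)))"
  have E: "?E \<ge> 0" using \<delta> by simp
  have h: "?h \<le> ?E"
  proof (cases b)
    case True
    thus ?thesis
      using prob_early_one_le[OF \<delta>, of g x l] spaced_ConsD(2)[OF Cons.prems] by simp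
  qed (use E in simp)
  have "trace_expectation \<delta> (b # x) (\<lambda>y. of_bool (crowded l y)) =
      \<delta> * ?c + (1 - \<delta>) * trace_expectation \<delta> x (\<lambda>y. of_bool (crowded l (b # y)))"
    using \<delta> by (rule trace_expectation_Cons)
  also have "trace_expectation \<delta> x (\<lambda>y. of_bool (crowded l (b # y))) \<le>
      trace_expectation \<delta> x (\<lambda>y. of_bool (crowded l y) + of_bool (b \<and> (\<exists>j<l. bit_at y j)))"
    by (rule trace_expectation_mono) (auto dest: crowded_ConsD)
  also have "\<dots> = ?c + ?h" by simp
  finally have "trace_expectation \<delta> (b # x) (\<lambda>y. of_bool (crowded l y)) \<le>
      \<delta> * ?c + (1 - \<delta>) * (?c + ?h)"
    using \<delta> by (simp add: mult_left_mono)
  also have "\<dots> = ?c + (1 - \<delta>) * ?h" by (simp add: algebra_simps)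
  also have "\<dots> \<le> ?c + 1 * ?E"
    using \<delta> h E by (intro add_left_mono mult_mono') (auto intro!: integral_nonneg_AE)
  also have "?c \<le> length x * ?E"
    using Cons.IH spaced_ConsD(1)[OF Cons.prems] by simp
  finally show ?case by (simp add: algebra_simps)
qed

section \<open>Local queries as affine functions of the bit probabilities\<close>

definition unit_word :: "nat \<Rightarrow> nat \<Rightarrow> bool list" where
  "unit_word l k = map (\<lambda>j. j = k) [0..<l]"

lemma window_not_crowded:
  assumes "\<not> crowded l y"
  shows "(\<forall>k<l. \<not> bit_at y (i + k)) \<or>
    (\<exists>k<l. window i l y = unit_word l k \<and> (\<forall>j<l. bit_at y (i + j) \<longleftrightarrow> j = k))"
proof (cases "\<exists>k<l. bit_at y (i + k)")
  case True
  then obtain k where k: "k < l" "bit_at y (i + k)" by blast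
  have eq: "bit_at y (i + j) \<longleftrightarrow> j = k" if "j < l" for j
  proof
    assume j: "bit_at y (i + j)"
    show "j = k"
    proof (rule ccontr)
      assume "j \<noteq> k"
      hence "crowded l y" unfolding crowded_def
        by (intro exI[of _ "i + min j k"] exI[of _ "i + max j k"])
           (use j k that in \<open>auto simp: min_def max_def\<close>)
      thus False using assms by simp
    qed
  qed (use k in simp)
  hence "window i l y = unit_word l k"
    by (auto simp: window_eq_bit_at unit_word_def intro!: nth_equalityI)
  thus ?thesis using k eq by blast
qed auto

text \<open>A function of a word with at most one \<open>1\<close> is affine in its bits.\<close>

lemma window_function_affine_approx:
  fixes f :: "bool list \<Rightarrow> real"
  assumes f: "\<And>w. length w = l \<Longrightarrow> f w \<in> {-1..1}"
  defines "z \<equiv> replicate l False"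
  shows "\<bar>f (window i l y) - (f z + (\<Sum>k<l. (f (unit_word l k) - f z) * of_bool (bit_at y (i + k))))\<bar>
    \<le> (2 + 2 * real l) * of_bool (crowded l y)"
proof (cases "crowded l y")
  case True
  \<comment> \<open>Crude bound for crowded traces: \<open>2\<close> from two values of
    \<open>f\<close>, and \<open>2\<close> for each of the \<open>l\<close> coefficients.\<close>
  have fz: "f z \<in> {-1..1}" by (rule f) (simp add: z_def)
  have fw: "f (window i l y) \<in> {-1..1}" by (rule f) (simp add: window_def)
  have "\<bar>f (unit_word l k) - f z\<bar> \<le> 2" for k
    using f[of "unit_word l k"] fz by (auto simp: unit_word_def abs_le_iff)
  hence "\<bar>\<Sum>k<l. (f (unit_word l k) - f z) * of_bool (bit_at y (i + k))\<bar> \<le> (\<Sum>k<l. 2)"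
    by (intro order.trans[OF sum_abs] sum_mono) (auto simp: abs_mult)
  thus ?thesis using True fz fw by auto
next
  case False
  from window_not_crowded[OF this, of i] show ?thesis
  proof (elim disjE exE conjE)
    assume *: "\<forall>k<l. \<not> bit_at y (i + k)"
    hence "window i l y = z"
      by (auto simp: window_eq_bit_at z_def intro!: nth_equalityI)
    thus ?thesis using * False by simp
  next
    fix k assume k: "k < l" "window i l y = unit_word l k" "\<forall>j<l. bit_at y (i + j) \<longleftrightarrow> j = k"
    have "(\<Sum>j<l. (f (unit_word l j) - f z) * of_bool (bit_at y (i + j))) =
        (\<Sum>j<l. if j = k then f (unit_word l k) - f z else 0)"
      by (intro sum.cong) (use k in auto)
    also have "\<dots> = f (unit_word l k) - f z" using k by simp
    finally show ?thesis using k False by simp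
  qed
qed

text \<open>Linearity turns the bits into \<open>bit_prob\<close>, and the pointwise error is
  weighted by the chance of a crowded trace.\<close>

lemma window_expectation_affine_approx:
  fixes f :: "bool list \<Rightarrow> real"
  assumes f: "\<And>w. length w = l \<Longrightarrow> f w \<in> {-1..1}"
  defines "z \<equiv> replicate l False"
  shows "\<bar>trace_expectation \<delta> x (\<lambda>y. f (window i l y)) -
      (f z + (\<Sum>k<l. (f (unit_word l k) - f z) * bit_prob \<delta> x (i + k)))\<bar>
    \<le> (2 + 2 * real l) * trace_expectation \<delta> x (\<lambda>y. of_bool (crowded l y))"
proof -
  let ?A = "\<lambda>y. f z + (\<Sum>k<l. (f (unit_word l k) - f z) * of_bool (bit_at y (i + k)))"
  have "f z + (\<Sum>k<l. (f (unit_word l k) - f z) * bit_prob \<delta> x (i + k)) = trace_expectation \<delta> x ?A"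
    unfolding bit_prob_def
    by (subst Bochner_Integration.integral_add)
       (simp_all add: Bochner_Integration.integral_sum del: sum_mult_of_bool_eq)
  hence "\<bar>trace_expectation \<delta> x (\<lambda>y. f (window i l y)) -
      (f z + (\<Sum>k<l. (f (unit_word l k) - f z) * bit_prob \<delta> x (i + k)))\<bar> =
      \<bar>trace_expectation \<delta> x (\<lambda>y. f (window i l y) - ?A y)\<bar>"
    by (simp only:) simp
  also have "\<dots> \<le> trace_expectation \<delta> x (\<lambda>y. \<bar>f (window i l y) - ?A y\<bar>)"
    by (rule integral_abs_bound)
  also have "\<dots> \<le> trace_expectation \<delta> x (\<lambda>y. (2 + 2 * real l) * of_bool (crowded l y))"
    by (rule trace_expectation_mono) (unfold z_def, rule window_function_affine_approx[OF f])
  also have "\<dots> = (2 + 2 * real l) * trace_expectation \<delta> x (\<lambda>y. of_bool (crowded l y))"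
    by simp
  finally show ?thesis .
qed

text \<open>The same affine form serves both strings, so the constant \<open>f z\<close> cancels:
  the approximation error counts twice, and each of the \<open>l\<close> coefficients, at most
  \<open>2\<close> in size, costs \<open>2 * \<eta>\<close>.\<close>

lemma local_query_expectation_diff_le:
  assumes q: "local_query n l q" and len: "length x = n" "length x' = n"
    and crowd: "trace_expectation \<delta> x (\<lambda>y. of_bool (crowded l y)) \<le> \<epsilon>"
               "trace_expectation \<delta> x' (\<lambda>y. of_bool (crowded l y)) \<le> \<epsilon>"
    and bits: "\<And>j. \<bar>bit_prob \<delta> x j - bit_prob \<delta> x' j\<bar> \<le> \<eta>"
  shows "\<bar>measure_pmf.expectation (padded_trace \<delta> x) q - measure_pmf.expectation (padded_trace \<delta> x') q\<bar>
    \<le> 4 * (1 + real l) * \<epsilon> + 2 * real l * \<eta>"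
proof -
  from q obtain i f where f: "\<And>w. length w = l \<Longrightarrow> f w \<in> {-1..1}"
    and qf: "\<And>y. length y = n \<Longrightarrow> q y = f (window i l y)"
    unfolding local_query_def by blast
  define z where "z = replicate l False"
  let ?E = "\<lambda>x. trace_expectation \<delta> x (\<lambda>y. f (window i l y))"
  let ?L = "\<lambda>x. \<Sum>k<l. (f (unit_word l k) - f z) * bit_prob \<delta> x (i + k)"
  have approx: "\<bar>?E u - (f z + ?L u)\<bar> \<le> (2 + 2 * real l) * \<epsilon>"
    if "trace_expectation \<delta> u (\<lambda>y. of_bool (crowded l y)) \<le> \<epsilon>" for u
    unfolding z_def
    by (rule order.trans[OF window_expectation_affine_approx[OF f]])
       (use that in \<open>auto intro!: mult_left_mono\<close>)
  have "f z \<in> {-1..1}" by (rule f) (simp add: z_def)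
  hence coeff: "\<bar>f (unit_word l k) - f z\<bar> \<le> 2" for k
    using f[of "unit_word l k"] by (auto simp: unit_word_def abs_le_iff)
  have "?L x - ?L x' = (\<Sum>k<l. (f (unit_word l k) - f z) * (bit_prob \<delta> x (i + k) - bit_prob \<delta> x' (i + k)))"
    by (simp only: sum_subtractf right_diff_distrib)
  hence "\<bar>?L x - ?L x'\<bar> \<le> (\<Sum>k<l. 2 * \<eta>)"
    by (simp only:) (intro order.trans[OF sum_abs] sum_mono, auto simp: abs_mult intro!: mult_mono coeff bits)
  moreover have "measure_pmf.expectation (padded_trace \<delta> u) q = ?E u" if "length u = n" for u
    using that by (intro expectation_padded_trace_local_query) (auto intro: qf)
  ultimately show ?thesis
    using approx[OF crowd(1)] approx[OF crowd(2)] len by (auto simp: abs_le_iff algebra_simps)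
qed

section \<open>The oracle answering with midpoints\<close>

text \<open>Induction on the decision tree. The midpoint is within
  \<open>\<tau>\<^sub>0 \<le> \<tau>\<close> of both expectations, hence a valid answer for both
  strings, and both runs continue in the same subtree.\<close>

lemma common_run_exists:
  assumes "local_sq_algorithm n l \<tau>\<^sub>0 A"
    and "\<And>q. local_query n l q \<Longrightarrow> \<bar>measure_pmf.expectation (padded_trace \<delta> x) q -
            measure_pmf.expectation (padded_trace \<delta> x') q\<bar> \<le> 2 * \<tau>\<^sub>0"
  shows "\<exists>z. sq_run \<delta> x A z \<and> sq_run \<delta> x' A z"
  using assms(1)
proof (induction A)
  case (Output z)
  thus ?case by (blast intro: run_output)
next
  case (Query q \<tau> k)
  let ?E = "\<lambda>x. measure_pmf.expectation (padded_trace \<delta> x) q"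
  define r where "r = (?E x + ?E x') / 2"
  have q: "local_query n l q" "\<tau>\<^sub>0 \<le> \<tau>" "local_sq_algorithm n l \<tau>\<^sub>0 (k r)"
    using Query.prems by auto
  obtain z where z: "sq_run \<delta> x (k r) z" "sq_run \<delta> x' (k r) z"
    using Query.IH[OF rangeI q(3)] by blast
  have "\<bar>?E x - ?E x'\<bar> \<le> 2 * \<tau>" using assms(2)[OF q(1)] q(2) by linarith
  hence "\<bar>r - ?E x\<bar> \<le> \<tau>" "\<bar>r - ?E x'\<bar> \<le> \<tau>"
    by (auto simp: r_def abs_le_iff field_simps)
  thus ?case using z by (blast intro: run_query)
qed

section \<open>Two sparse strings with nearly equal one-bit statistics\<close>

text \<open>As in Chernoff's bound, the tail is dominated by inserting the weights \<open>exp (r - D) \<ge> 1\<close>.\<close>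

lemma binomial_tail_norm_le:
  fixes h :: complex and D H :: nat
  assumes "m \<le> H"
  shows "norm (\<Sum>r\<in>{D..H}. of_nat (m choose r) * h ^ r) \<le> exp (exp 1 * norm h * H - D)"
proof -
  have "norm (\<Sum>r\<in>{D..H}. of_nat (m choose r) * h ^ r) \<le>
      (\<Sum>r\<in>{D..H}. real (m choose r) * norm h ^ r)"
    by (rule order.trans[OF norm_sum]) (simp add: norm_mult norm_power)
  also have "\<dots> \<le> (\<Sum>r\<in>{D..H}. real (m choose r) * norm h ^ r * exp (real r - real D))"
  proof (rule sum_mono)
    fix r assume "r \<in> {D..H}"
    hence "real (m choose r) * norm h ^ r * 1 \<le> real (m choose r) * norm h ^ r * exp (real r - real D)"
      by (intro mult_left_mono) auto
    thus "real (m choose r) * norm h ^ r \<le> real (m choose r) * norm h ^ r * exp (real r - real D)"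
      by simp
  qed
  also have "\<dots> \<le> (\<Sum>r\<le>H. real (m choose r) * norm h ^ r * exp (real r - real D))"
    by (intro sum_mono2) auto
  also have "\<dots> = (\<Sum>r\<le>m. real (m choose r) * norm h ^ r * exp (real r - real D))"
    by (intro sum.mono_neutral_right) (use assms in auto)
  also have "\<dots> = exp (- real D) * (\<Sum>r\<le>m. real (m choose r) * (exp 1 * norm h) ^ r * 1 ^ (m - r))"
    unfolding sum_distrib_left
    by (intro sum.cong) (auto simp: power_mult_distrib exp_diff exp_minus field_simps simp flip: exp_of_nat_mult)
  also have "(\<Sum>r\<le>m. real (m choose r) * (exp 1 * norm h) ^ r * 1 ^ (m - r)) = (exp 1 * norm h + 1) ^ m"
    by (rule binomial_ring[symmetric])
  also have "\<dots> \<le> exp (exp 1 * norm h) ^ m"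
    by (intro power_mono) (auto simp: add.commute)
  also have "\<dots> \<le> exp (exp 1 * norm h) ^ H"
    using assms by (intro power_increasing) auto
  finally show ?thesis
    by (simp add: exp_diff exp_minus field_simps flip: exp_of_nat_mult)
qed

text \<open>Expanding around \<open>1\<close> and summing over the set, the coefficient of
  \<open>h ^ r\<close> is the sum of \<open>m choose r\<close>. Orders below \<open>D\<close>
  therefore cancel and only the tails remain.\<close>

lemma power_sum_diff_norm_le:
  fixes h :: complex and D H :: nat
  assumes "finite S" "finite S'" "\<And>m. m \<in> S \<union> S' \<Longrightarrow> m \<le> H"
    and eq: "\<And>r. r < D \<Longrightarrow> (\<Sum>m\<in>S. m choose r) = (\<Sum>m\<in>S'. m choose r)"
  shows "norm ((\<Sum>m\<in>S. (1 + h) ^ m) - (\<Sum>m\<in>S'. (1 + h) ^ m)) \<le>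
    (card S + card S') * exp (exp 1 * norm h * H - D)"
proof -
  let ?lo = "\<lambda>m::nat. \<Sum>r::nat<D. of_nat (m choose r) * h ^ r"
  let ?hi = "\<lambda>m::nat. \<Sum>r\<in>{D..H}. of_nat (m choose r) * h ^ r"
  have split: "(1 + h) ^ m = ?lo m + ?hi m" if "m \<le> H" for m
  proof -
    have "(1 + h) ^ m = (\<Sum>r\<le>m. of_nat (m choose r) * h ^ r)"
      using binomial_ring[of h 1 m] by (simp add: add.commute)
    \<comment> \<open>The index set covers \<open>{..m}\<close> whether or not
      \<open>D \<le> H\<close>; the added binomial coefficients are zero.\<close>
    also have "\<dots> = (\<Sum>r\<in>{..<D} \<union> {D..H}. of_nat (m choose r) * h ^ r)"
      by (intro sum.mono_neutral_left) (use that in auto)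
    also have "\<dots> = ?lo m + ?hi m" by (rule sum.union_disjoint) auto
    finally show ?thesis .
  qed
  have lo: "(\<Sum>m\<in>T. ?lo m) = (\<Sum>r<D. of_nat (\<Sum>m\<in>T. m choose r) * h ^ r)" for T
    by (subst sum.swap) (simp add: sum_distrib_right)
  have hi: "norm (\<Sum>m\<in>T. ?hi m) \<le> card T * exp (exp 1 * norm h * H - D)" if "T \<subseteq> S \<union> S'" for T
    by (rule sum_norm_bound) (use that assms(3) in \<open>auto intro!: binomial_tail_norm_le\<close>)
  have lo_eq: "(\<Sum>m\<in>S. ?lo m) = (\<Sum>m\<in>S'. ?lo m)"
    unfolding lo by (rule sum.cong) (simp_all only: eq lessThan_iff)
  have lohi: "(\<Sum>m\<in>T. (1 + h) ^ m) = (\<Sum>m\<in>T. ?lo m) + (\<Sum>m\<in>T. ?hi m)" if "T \<subseteq> S \<union> S'" for T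
    unfolding sum.distrib[symmetric]
    by (intro sum.cong refl split) (use that assms(3) in auto)
  have "(\<Sum>m\<in>S. (1 + h) ^ m) - (\<Sum>m\<in>S'. (1 + h) ^ m) = (\<Sum>m\<in>S. ?hi m) - (\<Sum>m\<in>S'. ?hi m)"
    by (simp only: lohi[OF Un_upper1] lohi[OF Un_upper2] lo_eq add_diff_cancel_left)
  also have "norm \<dots> \<le> norm (\<Sum>m\<in>S. ?hi m) + norm (\<Sum>m\<in>S'. ?hi m)"
    by (rule norm_triangle_ineq4)
  also have "\<dots> \<le> (card S + card S') * exp (exp 1 * norm h * H - D)"
    using hi[of S] hi[of S'] by (simp add: algebra_simps)
  finally show ?thesis .
qed

text \<open>On the image of the unit circle, \<open>\<bar>w\<bar>\<^sup>2 = 1 - \<delta> / (1 - \<delta>) * \<bar>w - 1\<bar>\<^sup>2\<close>.\<close>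

lemma norm_deletion_circle_le:
  fixes z :: complex
  assumes \<delta>: "0 < \<delta>" "\<delta> < 1" and z: "norm z = 1"
  defines "h \<equiv> of_real (1 - \<delta>) * (z - 1)"
  shows "norm (1 + h) \<le> exp (- (\<delta> / (2 * (1 - \<delta>)) * (norm h)\<^sup>2))"
proof -
  have z': "(Re z)\<^sup>2 + (Im z)\<^sup>2 = 1" using z by (simp add: cmod_def)
  have "(1 - \<delta>) * (norm (1 + h))\<^sup>2 = (1 - \<delta>) - \<delta> * (norm h)\<^sup>2"
  proof -
    have "(norm h)\<^sup>2 = (1 - \<delta>)\<^sup>2 * (2 - 2 * Re z)"
      using z' unfolding cmod_power2 h_def by (simp add: power2_eq_square) algebra
    moreover have "(norm (1 + h))\<^sup>2 = 1 - \<delta> * (1 - \<delta>) * (2 - 2 * Re z)"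
      using z' unfolding cmod_power2 h_def by (simp add: power2_eq_square) algebra
    ultimately show ?thesis by algebra
  qed
  hence "(norm (1 + h))\<^sup>2 = 1 + (- (\<delta> / (1 - \<delta>) * (norm h)\<^sup>2))"
    using \<delta> by (simp add: field_simps)
  also have "\<dots> \<le> exp (- (\<delta> / (1 - \<delta>) * (norm h)\<^sup>2))" by (rule exp_ge_add_one_self)
  also have "\<dots> = (exp (- (\<delta> / (2 * (1 - \<delta>)) * (norm h)\<^sup>2)))\<^sup>2"
    using \<delta> by (simp add: divide_simps flip: exp_double)
  finally show ?thesis by (rule power2_le_imp_le) simp
qed

text \<open>Pigeonhole: a vector of \<open>D\<close> sums, each below \<open>n ^ D\<close>, takes at
  most \<open>n ^ (D * D)\<close> values, fewer than the \<open>2 ^ card P\<close> subsets of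
  \<open>P\<close>.\<close>

lemma equal_binomial_sums_exist:
  fixes P :: "nat set"
  assumes P: "finite P" "\<And>m. m \<in> P \<Longrightarrow> m \<le> n" "card P < n" and card: "n ^ (D * D) < 2 ^ card P"
  obtains T T' where "T \<subseteq> P" "T' \<subseteq> P" "T \<noteq> T'"
    "\<And>r. r < D \<Longrightarrow> (\<Sum>m\<in>T. m choose r) = (\<Sum>m\<in>T'. m choose r)"
proof -
  define F where "F T = (\<lambda>r\<in>{..<D}. \<Sum>m\<in>T. m choose r)" for T :: "nat set"
  have "F ` Pow P \<subseteq> {..<D} \<rightarrow>\<^sub>E {..<n ^ D}"
  proof (intro image_subsetI PiE_I)
    fix T r assume T: "T \<in> Pow P" and r: "r \<in> {..<D}"
    \<comment> \<open>The exponent \<open>D - 1\<close> leaves one factor \<open>n\<close> to absorb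
      the number of summands, which is below \<open>n\<close>.\<close>
    have "(\<Sum>m\<in>T. m choose r) \<le> (\<Sum>m\<in>T. n ^ (D - 1))"
    proof (rule sum_mono)
      fix m assume "m \<in> T"
      hence "m \<le> n" using T P by blast
      show "m choose r \<le> n ^ (D - 1)"
      proof (cases "r \<le> m")
        case True
        have "m choose r \<le> m ^ r" using True by (rule binomial_le_pow)
        also have "\<dots> \<le> n ^ r" using \<open>m \<le> n\<close> by (rule power_mono) simp
        also have "\<dots> \<le> n ^ (D - 1)" using r P(3) by (intro power_increasing) auto
        finally show ?thesis .
      qed (simp add: binomial_eq_0)
    qed
    also have "\<dots> = card T * n ^ (D - 1)" by simp
    also have "\<dots> \<le> card P * n ^ (D - 1)"
      using T P by (intro mult_right_mono card_mono) auto
    also have "\<dots> < n * n ^ (D - 1)"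
      using P(3) by (intro mult_strict_right_mono) auto
    also have "\<dots> = n ^ D" using r by (cases D) auto
    finally show "F T r \<in> {..<n ^ D}" using r by (simp add: F_def)
  qed (simp add: F_def)
  hence "card (F ` Pow P) \<le> card ({..<D} \<rightarrow>\<^sub>E {..<n ^ D})"
    by (intro card_mono finite_PiE) auto
  also have "\<dots> = n ^ (D * D)" by (simp add: card_PiE power_mult)
  also have "\<dots> < card (Pow P)" using card P by (simp add: card_Pow)
  finally have "\<not> inj_on F (Pow P)" by (rule pigeonhole)
  then obtain T T' where T: "T \<subseteq> P" "T' \<subseteq> P" "T \<noteq> T'" "F T = F T'"
    by (auto simp: inj_on_def)
  have "(\<Sum>m\<in>T. m choose r) = (\<Sum>m\<in>T'. m choose r)" if "r < D" for r
    using fun_cong[OF T(4), of r] that by (simp add: F_def)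
  with T(1-3) show ?thesis by (rule that)
qed

section \<open>Strings with ones at shifted positions\<close>

definition shifted_string :: "nat \<Rightarrow> nat \<Rightarrow> nat set \<Rightarrow> bool list" where
  "shifted_string n s T = map (\<lambda>m. s \<le> m \<and> m - s \<in> T) [0..<n]"

lemma length_shifted_string [simp]: "length (shifted_string n s T) = n"
  by (simp add: shifted_string_def)

lemma bit_at_shifted_string: "bit_at (shifted_string n s T) j \<longleftrightarrow> j < n \<and> s \<le> j \<and> j - s \<in> T"
  by (auto simp: bit_at_def shifted_string_def)

lemma shifted_string_inj:
  assumes "shifted_string n s T = shifted_string n s T'" "T \<union> T' \<subseteq> {..<n - s}"
  shows "T = T'"
proof (rule set_eqI)
  fix t
  have "bit_at (shifted_string n s T) (s + t) = bit_at (shifted_string n s T') (s + t)"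
    using assms(1) by simp
  thus "t \<in> T \<longleftrightarrow> t \<in> T'"
    using assms(2) by (auto simp: bit_at_shifted_string)
qed

lemma spaced_shifted_string:
  assumes "T \<subseteq> range ((*) G)"
  shows "spaced G (shifted_string n s T)"
  unfolding spaced_def bit_at_shifted_string
proof (intro allI impI, elim conjE)
  fix i j assume ij: "i < j" "s \<le> i" "i - s \<in> T" "j - s \<in> T"
  then obtain a b where ab: "i - s = G * a" "j - s = G * b" using assms by blast
  have "G * a < G * b" using ij ab by linarith
  hence "a < b" by simp
  hence "G * (a + 1) \<le> G * b" by (intro mult_le_mono2) simp
  thus "i + G \<le> j" using ij ab by (simp add: algebra_simps)
qed

text \<open>The offset yields the factor \<open>w ^ s\<close>. On the image of the unit circle it is
  small away from \<open>w = 1\<close> and there outweighs the growth of the remaining sum.\<close>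

lemma shifted_string_generating_function:
  fixes w :: "'a :: comm_ring_1"
  assumes "T \<subseteq> {..<n - s}"
  shows "(\<Sum>m<n. of_bool (shifted_string n s T ! m) * w ^ m) = w ^ s * (\<Sum>t\<in>T. w ^ t)"
proof -
  have "(\<Sum>m<n. of_bool (shifted_string n s T ! m) * w ^ m) =
      (\<Sum>m<n. if m \<in> (+) s ` T then w ^ m else 0)"
  proof (rule sum.cong)
    fix m assume "m \<in> {..<n}"
    moreover have "s \<le> m \<and> m - s \<in> T \<longleftrightarrow> m \<in> (+) s ` T"
      by (auto intro!: image_eqI[of _ _ "m - s"])
    ultimately show "of_bool (shifted_string n s T ! m) * w ^ m = (if m \<in> (+) s ` T then w ^ m else 0)"
      by (simp add: shifted_string_def)
  qed simp
  also have "\<dots> = (\<Sum>m\<in>{..<n} \<inter> (+) s ` T. w ^ m)"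
    by (simp add: sum.If_cases)
  also have "{..<n} \<inter> (+) s ` T = (+) s ` T" using assms by auto
  also have "(\<Sum>m\<in>(+) s ` T. w ^ m) = (\<Sum>t\<in>T. w ^ (s + t))"
    by (subst sum.reindex) auto
  also have "\<dots> = w ^ s * (\<Sum>t\<in>T. w ^ t)"
    by (simp add: power_add sum_distrib_left)
  finally show ?thesis .
qed

text \<open>Coefficients are bounded by the maximum on the unit circle. There the decay of
  \<open>w ^ s\<close> competes with the tail \<open>exp (e \<bar>h\<bar> H - D)\<close>, and
  \<open>small\<close> ensures that at least half of \<open>D\<close> remains in the
  exponent.\<close>

lemma bit_prob_shifted_string_diff_le:
  assumes \<delta>: "0 < \<delta>" "\<delta> < 1" and T: "T \<subseteq> {..H}" "T' \<subseteq> {..H}" and s: "0 < s" "s + H < n"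
    and eq: "\<And>r. r < D \<Longrightarrow> (\<Sum>m\<in>T. m choose r) = (\<Sum>m\<in>T'. m choose r)"
    and small: "exp 1 ^ 2 * (1 - \<delta>) * real H ^ 2 \<le> \<delta> * real s * real D"
  shows "\<bar>bit_prob \<delta> (shifted_string n s T) j - bit_prob \<delta> (shifted_string n s T') j\<bar>
    \<le> (card T + card T') * exp (- (real D / 2))"
proof (cases "j < n")
  case True
  let ?x = "shifted_string n s T" and ?x' = "shifted_string n s T'"
  have sub: "T \<subseteq> {..<n - s}" "T' \<subseteq> {..<n - s}" using T s by auto
  have "norm (complex_of_real (bit_prob \<delta> ?x j - bit_prob \<delta> ?x' j))
      \<le> (card T + card T') * exp (- (real D / 2))"
  proof (rule norm_coeff_le_sup_unit_circle[OF _ True])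
    fix z :: complex assume z: "norm z = 1"
    define h where "h = of_real (1 - \<delta>) * (z - 1)"
    define \<kappa> where "\<kappa> = \<delta> / (2 * (1 - \<delta>))"
    have w: "of_real \<delta> + of_real (1 - \<delta>) * z = 1 + h" by (simp add: h_def algebra_simps)
    have \<kappa>: "\<kappa> > 0" using \<delta> by (simp add: \<kappa>_def)
    have gf: "(\<Sum>i<n. of_real (bit_prob \<delta> (shifted_string n s U) i) * z ^ i) =
        of_real (1 - \<delta>) * ((1 + h) ^ s * (\<Sum>t\<in>U. (1 + h) ^ t))" if "U \<subseteq> {..<n - s}" for U
      using bit_prob_generating_function[of \<delta> "shifted_string n s U" z] \<delta>
        shifted_string_generating_function[OF that, of "1 + h"]
      by (simp only: w length_shifted_string less_imp_le)
    have "(\<Sum>i<n. of_real (bit_prob \<delta> ?x i - bit_prob \<delta> ?x' i) * z ^ i) =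
        of_real (1 - \<delta>) * ((1 + h) ^ s * ((\<Sum>t\<in>T. (1 + h) ^ t) - (\<Sum>t\<in>T'. (1 + h) ^ t)))"
      by (simp only: of_real_diff left_diff_distrib sum_subtractf gf[OF sub(1)] gf[OF sub(2)] right_diff_distrib)
    hence "norm (\<Sum>i<n. of_real (bit_prob \<delta> ?x i - bit_prob \<delta> ?x' i) * z ^ i) =
        (1 - \<delta>) * (norm (1 + h) ^ s * norm ((\<Sum>t\<in>T. (1 + h) ^ t) - (\<Sum>t\<in>T'. (1 + h) ^ t)))"
      using \<delta> by (simp add: norm_mult norm_power del: of_real_diff)
    also have "\<dots> \<le> 1 * (exp (- (\<kappa> * (norm h)\<^sup>2)) ^ s * ((card T + card T') * exp (exp 1 * norm h * H - D)))"
      using \<delta> T unfolding \<kappa>_def h_def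
      by (intro mult_mono power_mono power_sum_diff_norm_le norm_deletion_circle_le z eq)
         (auto intro: finite_subset)
    also have "\<dots> = (card T + card T') * exp (exp 1 * H * norm h - \<kappa> * s * (norm h)\<^sup>2 - D)"
      by (simp add: mult_ac flip: exp_of_nat_mult exp_add)
    also have "\<dots> \<le> (card T + card T') * exp (- (real D / 2))"
    proof -
      \<comment> \<open>Completing the square: \<open>e H t - \<kappa> s t\<^sup>2\<close> is at
        most \<open>(e H)\<^sup>2 / (4 \<kappa> s)\<close>, which \<open>small\<close> bounds by
        \<open>D / 2\<close>.\<close>
      have "0 \<le> (exp 1 * H - 2 * \<kappa> * s * norm h)\<^sup>2" by simp
      hence "4 * (\<kappa> * s) * (exp 1 * H * norm h - \<kappa> * s * (norm h)\<^sup>2) \<le> exp 1 ^ 2 * real H ^ 2"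
        by (simp add: power2_eq_square algebra_simps)
      also have "\<dots> \<le> 4 * (\<kappa> * s) * (D / 2)"
        using small \<delta> by (simp add: \<kappa>_def field_simps)
      finally have "exp 1 * H * norm h - \<kappa> * s * (norm h)\<^sup>2 \<le> D / 2"
        using \<kappa> s by (subst (asm) mult_le_cancel_left_pos) auto
      thus ?thesis by (intro mult_left_mono) auto
    qed
    finally show "norm (\<Sum>i<n. of_real (bit_prob \<delta> ?x i - bit_prob \<delta> ?x' i) * z ^ i)
        \<le> (card T + card T') * exp (- (real D / 2))" .
  qed
  thus ?thesis by (simp only: norm_of_real)
qed (simp add: bit_prob_eq_0)

section \<open>Choice of parameters\<close>

text \<open>
  With \<open>Suc g \<le> 5 \<Lambda> / p\<close>, \<open>N \<le> 5 (a \<Lambda>)\<^sup>2 log 2 n\<close>, \<open>s \<ge> n / 3\<close> and \<open>exp 1 \<le> 3\<close>, the smallness condition on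
  \<open>H = Suc g * N\<close> reduces to \<open>3 * 9 * 625 * a\<^sup>3 \<le> \<delta> (1 - \<delta>)\<close>; this is where \<open>16875\<close> comes from.
\<close>

lemma indistinguishable_pair_exists:
  fixes n :: nat and \<delta> \<Lambda> a :: real
  assumes \<delta>: "0 < \<delta>" "\<delta> < 1"
  defines "a \<equiv> \<delta> * (1 - \<delta>) / 16875"
  assumes n: "2 \<le> n" and \<Lambda>_pow: "\<Lambda> ^ 5 * log 2 n ^ 2 = n"
    and \<Lambda>: "2 \<le> \<Lambda>" "1 \<le> a * \<Lambda>" "2500 * \<Lambda> < n" "5 * real n ^ 2 \<le> exp (a * \<Lambda> / 4)"
  obtains x x' where "length x = n" "length x' = n" "x \<noteq> x'"
    "\<And>l q. real l \<le> \<Lambda> \<Longrightarrow> local_query n l q \<Longrightarrow>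
       \<bar>measure_pmf.expectation (padded_trace \<delta> x) q - measure_pmf.expectation (padded_trace \<delta> x') q\<bar>
         \<le> 2 * exp (- (a / 4 * \<Lambda>))"
proof -
  define p where "p = 1 - \<delta>"
  have p: "0 < p" "p < 1" using \<delta> by (auto simp: p_def)
  have a: "0 < a" "a \<le> 1" "a \<le> p" "16875 * a = \<delta> * p"
  proof -
    show a_eq: "16875 * a = \<delta> * p" by (simp add: a_def p_def)
    have "0 < \<delta> * p" "\<delta> * p \<le> 1 * p" using \<delta> p by simp_all
    with a_eq p show "0 < a" "a \<le> 1" "a \<le> p" by linarith+
  qed
  define lg where "lg = log 2 n"
  have lg: "1 \<le> lg" using n by (simp add: lg_def le_log_iff)
  \<comment> \<open>The spacing is chosen so that
    \<open>exp (- p / 2) ^ g \<le> exp (- 2 \<Lambda>)\<close>, which beats the factor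
    \<open>exp l\<close>.\<close>
  define g where "g = nat \<lceil>4 * \<Lambda> / p\<rceil>"
  define D where "D = nat \<lceil>a * \<Lambda>\<rceil>"
  \<comment> \<open>Strictly above \<open>D\<^sup>2 log 2 n\<close>, so that \<open>2 ^ N\<close>
    exceeds \<open>n ^ (D * D)\<close>.\<close>
  define N where "N = Suc (nat \<lfloor>real (D * D) * lg\<rfloor>)"
  define s where "s = n div 2"
  define H where "H = Suc g * N"
  have g: "4 * \<Lambda> / p \<le> g" "Suc g \<le> 5 * \<Lambda> / p"
  proof -
    show "4 * \<Lambda> / p \<le> g" unfolding g_def by linarith
    have "real g \<le> 4 * \<Lambda> / p + 1"
    proof -
      have "0 \<le> 4 * \<Lambda> / p" using \<Lambda> p by simp
      thus ?thesis unfolding g_def by linarith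
    qed
    \<comment> \<open>Since \<open>Suc g \<le> 4 \<Lambda> / p + 2\<close>, the rounding fits into
      one more \<open>\<Lambda> / p\<close>.\<close>
    moreover have "2 \<le> \<Lambda> / p" using \<Lambda> p by (simp add: field_simps)
    moreover have "5 * \<Lambda> / p = 4 * \<Lambda> / p + \<Lambda> / p" by (simp add: field_simps)
    ultimately show "Suc g \<le> 5 * \<Lambda> / p" by simp
  qed
  have D: "a * \<Lambda> \<le> D" "D \<le> 2 * (a * \<Lambda>)"
    using \<Lambda>(2) unfolding D_def by linarith+
  have N: "real (D * D) * lg < N" "N \<le> 5 * (a * \<Lambda>)\<^sup>2 * lg"
  proof -
    have nn: "0 \<le> real (D * D) * lg" using lg by simp
    thus "real (D * D) * lg < N" unfolding N_def by linarith
    have "real (D * D) \<le> (2 * (a * \<Lambda>)) * (2 * (a * \<Lambda>))"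
      using D by (simp only: of_nat_mult) (intro mult_mono, auto)
    hence "real (D * D) * lg \<le> (2 * (a * \<Lambda>)) * (2 * (a * \<Lambda>)) * lg"
      using lg by (intro mult_right_mono) auto
    also have "\<dots> = 4 * (a * \<Lambda>)\<^sup>2 * lg" by (simp add: power2_eq_square)
    finally have "real (D * D) * lg \<le> 4 * (a * \<Lambda>)\<^sup>2 * lg" .
    moreover have "1 * 1 \<le> (a * \<Lambda>)\<^sup>2 * lg" using \<Lambda>(2) lg by (intro mult_mono one_le_power) auto
    moreover have "real N \<le> real (D * D) * lg + 1" using nn unfolding N_def by linarith
    ultimately show "N \<le> 5 * (a * \<Lambda>)\<^sup>2 * lg" by linarith
  qed
  have "real H \<le> (5 * \<Lambda> / p) * (5 * (a * \<Lambda>)\<^sup>2 * lg)"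
    unfolding H_def of_nat_mult using g N \<Lambda> p by (intro mult_mono) auto
  hence "real H ^ 2 \<le> ((5 * \<Lambda> / p) * (5 * (a * \<Lambda>)\<^sup>2 * lg)) ^ 2"
    by (intro power_mono) auto
  \<comment> \<open>The exponents \<open>1/5\<close> and \<open>2/5\<close> enter here:
    \<open>\<Lambda> ^ 5 * lg ^ 2 = n\<close> makes \<open>H ^ 2\<close> of order
    \<open>a ^ 4 * \<Lambda> * n\<close>.\<close>
  also have "\<dots> = 625 * a ^ 4 * \<Lambda> * (\<Lambda> ^ 5 * lg ^ 2) / p ^ 2"
    by (simp add: power_mult_distrib power_divide flip: power_mult) (simp add: field_simps eval_nat_numeral)
  finally have H2: "real H ^ 2 \<le> 625 * a ^ 4 * \<Lambda> * n / p ^ 2"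
    using \<Lambda>_pow by (simp add: lg_def)
  have "n \<le> 3 * s" using n unfolding s_def by linarith
  hence s: "n / 3 \<le> real s" "0 < s" "2 * s \<le> n" using n by (auto simp: s_def)
  \<comment> \<open>Together with \<open>2 * s \<le> n\<close> this fits the shifted positions into
    \<open>n\<close> bits. The factor \<open>p\<close> disappears by
    \<open>a ^ 4 \<le> p ^ 2\<close>.\<close>
  have H: "2 * real H < n"
  proof -
    have "a ^ 4 \<le> p ^ 2"
    proof -
      have "a ^ 4 = a ^ 2 * a ^ 2" by (simp flip: power_add)
      also have "\<dots> \<le> p ^ 2 * 1" using a p by (intro mult_mono power_mono power_le_one) auto
      finally show ?thesis by simp
    qed
    hence "625 * (a ^ 4 / p ^ 2) * (\<Lambda> * n) \<le> 625 * 1 * (\<Lambda> * n)"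
      using \<Lambda> p by (intro mult_right_mono mult_left_mono) auto
    hence "real H ^ 2 \<le> 625 * (\<Lambda> * n)" using H2 by simp
    hence "(2 * real H) ^ 2 \<le> 2500 * \<Lambda> * n" by (simp add: power_mult_distrib)
    also have "\<dots> < real n * real n" using \<Lambda>(3) n by (intro mult_strict_right_mono) auto
    finally have "(2 * real H) ^ 2 < real n ^ 2" by (simp add: power2_eq_square)
    thus ?thesis by (rule power2_less_imp_less) simp
  qed
  have N_le: "N \<le> H" by (simp add: H_def)
  have small: "exp 1 ^ 2 * (1 - \<delta>) * real H ^ 2 \<le> \<delta> * real s * real D"
  proof -
    have "exp 1 ^ 2 * p * real H ^ 2 \<le> 3 ^ 2 * p * (625 * a ^ 4 * \<Lambda> * n / p ^ 2)"
      using p H2 exp_le by (intro mult_mono power_mono) auto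
    also have "\<dots> = 16875 * a * (a ^ 3 * \<Lambda> * n) / (3 * p)"
      using p by (simp add: field_simps eval_nat_numeral)
    also have "\<dots> = \<delta> * (n / 3) * (a ^ 3 * \<Lambda>)"
      using p a(4) by (simp add: field_simps)
    also have "\<dots> \<le> \<delta> * s * D"
    proof (intro mult_mono)
      have "a ^ 3 \<le> a ^ 1" using a by (intro power_decreasing) auto
      hence "a ^ 3 * \<Lambda> \<le> a * \<Lambda>" using \<Lambda> by (intro mult_right_mono) auto
      thus "a ^ 3 * \<Lambda> \<le> D" using D by linarith
    qed (use \<delta> s a \<Lambda> in auto)
    finally show ?thesis by (simp add: p_def)
  qed
  define P where "P = (*) (Suc g) ` {..<N}"
  have P: "finite P" "card P = N" "P \<subseteq> {..H}" "P \<subseteq> range ((*) (Suc g))"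
    by (auto simp: P_def card_image inj_on_def H_def intro!: mult_le_mono simp del: mult_Suc)
  have "real (n ^ (D * D)) = 2 powr (lg * (D * D))"
    using n by (simp add: lg_def powr_realpow power_mult flip: powr_powr)
  also have "\<dots> < 2 powr N" using N(1) by (simp add: mult.commute)
  finally have "real (n ^ (D * D)) < real (2 ^ N)" by (simp add: powr_realpow)
  hence card: "n ^ (D * D) < 2 ^ card P" unfolding of_nat_less_iff P(2) .
  obtain T T' where T: "T \<subseteq> P" "T' \<subseteq> P" "T \<noteq> T'"
    and eq: "\<And>r. r < D \<Longrightarrow> (\<Sum>m\<in>T. m choose r) = (\<Sum>m\<in>T'. m choose r)"
    by (rule equal_binomial_sums_exist[OF P(1) _ _ card]) (use P H N_le in auto)
  let ?x = "shifted_string n s T" and ?x' = "shifted_string n s T'"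
  have sH: "s + H < n" using H s by linarith
  \<comment> \<open>A common bound for both errors: \<open>D \<ge> a * \<Lambda>\<close> gives it
    for the bits, \<open>a \<le> 1\<close> for the crowded traces.\<close>
  define \<epsilon> where "\<epsilon> = n * exp (- (a * \<Lambda> / 2))"
  have bits: "\<bar>bit_prob \<delta> ?x j - bit_prob \<delta> ?x' j\<bar> \<le> \<epsilon>" for j
  proof -
    have "T \<subseteq> {..H}" "T' \<subseteq> {..H}" using T P by auto
    hence "\<bar>bit_prob \<delta> ?x j - bit_prob \<delta> ?x' j\<bar> \<le> (card T + card T') * exp (- (real D / 2))"
      by (rule bit_prob_shifted_string_diff_le[OF \<delta> _ _ s(2) sH eq small])
    also have "\<dots> \<le> n * exp (- (a * \<Lambda> / 2))"
    proof (intro mult_mono)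
      have "card T \<le> N" "card T' \<le> N" using T P card_mono by metis+
      thus "real (card T + card T') \<le> n" using N_le H by simp
    qed (use D in auto)
    finally show ?thesis by (simp add: \<epsilon>_def)
  qed
  have crowd: "trace_expectation \<delta> (shifted_string n s U) (\<lambda>y. of_bool (crowded l y)) \<le> \<epsilon>"
    if "U \<subseteq> P" "real l \<le> \<Lambda>" for U l
  proof -
    have "spaced (Suc g) (shifted_string n s U)"
      using that P by (intro spaced_shifted_string) auto
    from prob_crowded_le[OF _ _ this, of \<delta> l] have
      "trace_expectation \<delta> (shifted_string n s U) (\<lambda>y. of_bool (crowded l y)) \<le>
        n * (exp l * (\<delta> + (1 - \<delta>) * exp (-1)) ^ g)" using \<delta> by simp
    also have "\<dots> \<le> n * (exp \<Lambda> * exp (- (2 * \<Lambda>)))"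
    proof (intro mult_left_mono mult_mono)
      \<comment> \<open>Then the base is at most
        \<open>1 - p / 2 \<le> exp (- (p / 2))\<close>.\<close>
      have "exp (-1) \<le> (1 / 2 :: real)"
        using exp_ge_add_one_self[of "1::real"] by (simp add: exp_minus field_simps)
      hence "p * exp (-1) \<le> p * (1 / 2)" using p by (intro mult_left_mono) auto
      moreover have "\<delta> = 1 - p" by (simp add: p_def)
      ultimately have "\<delta> + (1 - \<delta>) * exp (-1) \<le> 1 + (- (p / 2))" by simp
      also have "\<dots> \<le> exp (- (p / 2))" by (rule exp_ge_add_one_self)
      finally have "(\<delta> + (1 - \<delta>) * exp (-1)) ^ g \<le> exp (- (p / 2)) ^ g"
        using \<delta> by (intro power_mono) auto
      also have "\<dots> = exp (- (p / 2 * g))" by (simp flip: exp_of_nat_mult add: mult.commute)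
      also have "\<dots> \<le> exp (- (2 * \<Lambda>))" using g(1) p by (simp add: field_simps)
      finally show "(\<delta> + (1 - \<delta>) * exp (-1)) ^ g \<le> exp (- (2 * \<Lambda>))" .
    qed (use that \<delta> in auto)
    also have "exp \<Lambda> * exp (- (2 * \<Lambda>)) = exp (- \<Lambda>)" by (simp flip: exp_add)
    also have "n * exp (- \<Lambda>) \<le> n * exp (- (a * \<Lambda> / 2))"
    proof (intro mult_left_mono)
      have "a * \<Lambda> \<le> 1 * \<Lambda>" using a \<Lambda> by (intro mult_right_mono) auto
      thus "exp (- \<Lambda>) \<le> exp (- (a * \<Lambda> / 2))" using \<Lambda> by simp
    qed simp
    finally show ?thesis by (simp add: \<epsilon>_def)
  qed
  show ?thesis
  proof (rule that[of ?x ?x'])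
    show "?x \<noteq> ?x'"
      using shifted_string_inj[of n s T T'] T P sH by fastforce
    fix l q assume l: "real l \<le> \<Lambda>" and q: "local_query n l q"
    have "\<bar>measure_pmf.expectation (padded_trace \<delta> ?x) q - measure_pmf.expectation (padded_trace \<delta> ?x') q\<bar>
        \<le> 4 * (1 + real l) * \<epsilon> + 2 * real l * \<epsilon>"
      by (rule local_query_expectation_diff_le[OF q _ _ crowd crowd bits]) (use T l in auto)
    also have "\<dots> = (4 + 6 * real l) * \<epsilon>" by (simp add: algebra_simps)
    \<comment> \<open>As \<open>l \<le> \<Lambda> < n\<close>, the polynomial factors amount to at
      most \<open>10 n\<^sup>2\<close>; half of the decay \<open>exp (- (a * \<Lambda> / 2))\<close>
      absorbs them up to the factor \<open>2\<close>.\<close>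
    also have "\<dots> \<le> (10 * n) * \<epsilon>"
      using l \<Lambda> n by (intro mult_right_mono) (auto simp: \<epsilon>_def)
    also have "\<dots> = 2 * (5 * real n ^ 2) * exp (- (a * \<Lambda> / 2))"
      by (simp add: \<epsilon>_def power2_eq_square)
    also have "\<dots> \<le> 2 * exp (a * \<Lambda> / 4) * exp (- (a * \<Lambda> / 2))"
      using \<Lambda>(4) by (intro mult_mono) auto
    also have "\<dots> = 2 * exp (- (a / 4 * \<Lambda>))"
      by (simp flip: exp_add)
    finally show "\<bar>measure_pmf.expectation (padded_trace \<delta> ?x) q -
        measure_pmf.expectation (padded_trace \<delta> ?x') q\<bar> \<le> 2 * exp (- (a / 4 * \<Lambda>))" .
  qed auto
qed

section \<open>Asymptotics and the bound on the tolerance\<close>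

theorem theorem3p1:
  "\<exists>c\<^sub>0>0. \<forall>\<delta>::real. 0 < \<delta> \<and> \<delta> < 1 \<longrightarrow>
     (\<exists>c>0. \<forall>\<^sub>F n in sequentially. \<forall>(l::nat) (\<tau>\<^sub>0::real) A.
        real l \<le> c\<^sub>0 * (real n powr (1/5) / log 2 (real n) powr (2/5)) \<longrightarrow>
        local_sq_algorithm n l \<tau>\<^sub>0 A \<longrightarrow>
        solves_trace_reconstruction \<delta> n A \<longrightarrow>
        \<tau>\<^sub>0 < exp (- (c * (real n powr (1/5) / log 2 (real n) powr (2/5)))))"
proof (rule exI[of _ 1], intro conjI allI impI; (elim conjE)?)
  \<comment> \<open>\<open>c\<^sub>0 = 1\<close> works for every \<delta> because the spacing of the
    ones, of order \<open>\<Lambda> / (1 - \<delta>)\<close>, compensates the deletion rate; only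
    \<open>c = a / 4\<close> and the threshold on \<open>n\<close> depend on \<delta>.\<close>
  fix \<delta> :: real assume \<delta>: "0 < \<delta>" "\<delta> < 1"
  define a where "a = \<delta> * (1 - \<delta>) / 16875"
  define \<Lambda> where "\<Lambda> n = real n powr (1/5) / log 2 (real n) powr (2/5)" for n
  have a: "a > 0" using \<delta> by (simp add: a_def)
  \<comment> \<open>These are the size conditions on \<open>\<Lambda>\<close>; the last holds
    because \<open>\<Lambda> n\<close> outgrows every multiple of \<open>log 2 n\<close>.\<close>
  have "\<forall>\<^sub>F n in sequentially. 2 \<le> \<Lambda> n"
    unfolding \<Lambda>_def by real_asymp
  moreover have "\<forall>\<^sub>F n in sequentially. 1 \<le> a * \<Lambda> n"
    unfolding \<Lambda>_def using a by real_asymp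
  moreover have "\<forall>\<^sub>F n in sequentially. 2500 * \<Lambda> n < n"
    unfolding \<Lambda>_def by real_asymp
  moreover have "\<forall>\<^sub>F n in sequentially. 5 * real n ^ 2 \<le> exp (a * \<Lambda> n / 4)"
    unfolding \<Lambda>_def using a by real_asymp
  ultimately have "\<forall>\<^sub>F n in sequentially. \<forall>(l::nat) (\<tau>\<^sub>0::real) A.
        real l \<le> 1 * \<Lambda> n \<longrightarrow> local_sq_algorithm n l \<tau>\<^sub>0 A \<longrightarrow>
        solves_trace_reconstruction \<delta> n A \<longrightarrow> \<tau>\<^sub>0 < exp (- (a / 4 * \<Lambda> n))"
    using eventually_ge_at_top[of 2]
  proof eventually_elim
    case (elim n)
    have "\<Lambda> n ^ 5 * log 2 n ^ 2 = n"
    proof -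
      have "log 2 n > 0" using elim by simp
      hence "(log 2 n powr (2/5)) ^ 5 = log 2 n ^ 2"
        by (simp add: powr_power)
      moreover have "(real n powr (1/5)) ^ 5 = n"
        using elim by (simp add: powr_power)
      ultimately show ?thesis
        using \<open>log 2 n > 0\<close> by (simp add: \<Lambda>_def power_divide)
    qed
    then obtain x x' where x: "length x = n" "length x' = n" "x \<noteq> x'"
      and close: "\<And>l q. real l \<le> \<Lambda> n \<Longrightarrow> local_query n l q \<Longrightarrow>
        \<bar>measure_pmf.expectation (padded_trace \<delta> x) q - measure_pmf.expectation (padded_trace \<delta> x') q\<bar>
          \<le> 2 * exp (- (a / 4 * \<Lambda> n))"
      using indistinguishable_pair_exists[OF \<delta>, of n "\<Lambda> n"] elim unfolding a_def by metis
    show ?case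
    proof (intro allI impI)
      fix l \<tau>\<^sub>0 A
      assume l: "real l \<le> 1 * \<Lambda> n" and A: "local_sq_algorithm n l \<tau>\<^sub>0 A"
        and solves: "solves_trace_reconstruction \<delta> n A"
      show "\<tau>\<^sub>0 < exp (- (a / 4 * \<Lambda> n))"
      proof (rule ccontr)
        assume \<tau>: "\<not> \<tau>\<^sub>0 < exp (- (a / 4 * \<Lambda> n))"
        \<comment> \<open>Both strings allow a run with the same output, which can equal only one of
          them.\<close>
        have "\<exists>z. sq_run \<delta> x A z \<and> sq_run \<delta> x' A z"
        proof (rule common_run_exists[OF A])
          fix q assume "local_query n l q"
          from close[OF _ this] l \<tau>
          show "\<bar>measure_pmf.expectation (padded_trace \<delta> x) q -
              measure_pmf.expectation (padded_trace \<delta> x') q\<bar> \<le> 2 * \<tau>\<^sub>0" by simp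
        qed
        thus False using solves x unfolding solves_trace_reconstruction_def by metis
      qed
    qed
  qed
  thus "\<exists>c>0. \<forall>\<^sub>F n in sequentially. \<forall>(l::nat) (\<tau>\<^sub>0::real) A.
        real l \<le> 1 * (real n powr (1/5) / log 2 (real n) powr (2/5)) \<longrightarrow>
        local_sq_algorithm n l \<tau>\<^sub>0 A \<longrightarrow>
        solves_trace_reconstruction \<delta> n A \<longrightarrow>
        \<tau>\<^sub>0 < exp (- (c * (real n powr (1/5) / log 2 (real n) powr (2/5))))"
    unfolding \<Lambda>_def using a by (intro exI[of _ "a / 4"]) simp
qed simp

end
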